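(* Let $R$ be a finite commutative ring with identity. If the unit-zero divisor graph $G_{UZ}(R)$ is a complete bipartite graph, then $R$ is a local ring.
   Context: For a finite commutative ring $R$ with identity, $U(R)$ is the set of units and $Z(R)$ is the set of zero divisors, with the convention $0\in Z(R)$. The unit-zero divisor graph $G_{UZ}(R)$ is the simple undirected graph whose vertex set is the set of all elements of $R$, where two distinct vertices $u,v$ are adjacent if and only if $u+v\in U(R)$ and $uv\in Z(R)$. A commutative ring with identity is local if it has a unique maximal ideal. A complete bipartite graph is a graph isomorphic to $K_{m,n}$ for some $m,n\ge 1$. *)

theory Defs
  imports "HOL-Algebra.Ideal" "Graph_Theory.Kuratowski"
begin

definition zero_divisors :: "('a, 'b) ring_scheme \<Rightarrow> 'a set" where
  "zero_divisors R =
     insert \<zero>\<^bsub>R\<^esub>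
       {a \<in> carrier R. \<exists>b \<in> carrier R. b \<noteq> \<zero>\<^bsub>R\<^esub> \<and> a \<otimes>\<^bsub>R\<^esub> b = \<zero>\<^bsub>R\<^esub>}"

definition local_ring :: "('a, 'b) ring_scheme \<Rightarrow> bool" where
  "local_ring R \<longleftrightarrow> cring R \<and> (\<exists>!M. maximalideal M R)"

(* The simple undirected graph is encoded as a symmetric loop-free digraph: an edge
   {u, v} is represented by the two arcs (u, v) and (v, u). *)
definition unit_zero_divisor_graph :: "('a, 'b) ring_scheme \<Rightarrow> 'a pair_pre_digraph" where
  "unit_zero_divisor_graph R =
     \<lparr> pverts = carrier R,
       parcs = {(u, v). u \<in> carrier R \<and> v \<in> carrier R \<and> u \<noteq> v \<and>
                  u \<oplus>\<^bsub>R\<^esub> v \<in> Units R \<and> u \<otimes>\<^bsub>R\<^esub> v \<in> zero_divisors R} \<rparr>"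

(* The library predicate for K(m, n) says that a graph has the shape of K(m, n), hence is
   closed under isomorphism; it also allows m = 0 or n = 0, which is excluded here. *)
definition complete_bipartite :: "('a, 'b) pre_digraph \<Rightarrow> bool" where
  "complete_bipartite G \<longleftrightarrow>
     (\<exists>m n. m \<ge> 1 \<and> n \<ge> 1 \<and> complete_bipartite_digraph m n G)"

end

theory Submission
  imports Defs "HOL-Algebra.Divisibility"
begin

text \<open>In a complete bipartite \<open>G\<^sub>U\<^sub>Z(R)\<close> the neighbours of \<open>0\<close> are the units, so the
  two sides are the units and the non-units. Hence non-unit plus unit is always a unit, which forces
  the non-units to be closed under addition; they then form the unique maximal ideal.\<close>

lemma (in cring) nonunit_mult_closed:
  assumes "a \<in> carrier R - Units R" "x \<in> carrier R"
  shows "x \<otimes> a \<in> carrier R - Units R"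
  using assms unit_factor[of a x] m_comm[of x a] by auto

lemma (in cring) nonunit_minus:
  assumes "a \<in> carrier R - Units R"
  shows "\<ominus> a \<in> carrier R - Units R"
  using nonunit_mult_closed[OF assms, of "\<ominus> \<one>"] assms by (simp add: l_minus)

text \<open>A unit in \<open>I\<close> would force \<open>\<one> \<in> I\<close>. This bound gives
  both maximality and uniqueness in \<open>local_ringI\<close>.\<close>

lemma (in cring) ideal_subset_nonunits:
  assumes "ideal I R" "I \<noteq> carrier R"
  shows "I \<subseteq> carrier R - Units R"
proof
  interpret ideal I R by fact
  fix a assume a: "a \<in> I"
  show "a \<in> carrier R - Units R"
  proof (rule ccontr)
    assume "a \<notin> carrier R - Units R"
    then have u: "a \<in> Units R" using a a_subset by auto
    then have "inv a \<otimes> a \<in> I" using a by (intro I_l_closed) auto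
    then have "\<one> \<in> I" using u by simp
    then show False using one_imp_carrier assms(2) by blast
  qed
qed

text \<open>The two assumptions make the non-units an ideal: \<open>zero\<close> supplies an
  element, \<open>add\<close> closure under sums. Since every proper ideal lies inside it, no other
  ideal can be maximal.\<close>

lemma (in cring) local_ringI:
  assumes zero: "\<zero> \<notin> Units R"
    and add: "\<And>a b. a \<in> carrier R - Units R \<Longrightarrow> b \<in> carrier R - Units R \<Longrightarrow> a \<oplus> b \<notin> Units R"
  shows "local_ring R"
proof -
  let ?N = "carrier R - Units R"
  have N: "ideal ?N R"
  proof (rule idealI)
    show "ring R" by (rule ring_axioms)
    show "subgroup ?N (add_monoid R)"
      by (rule add.subgroupI) (use zero add nonunit_minus in \<open>auto simp: a_inv_def\<close>)
    fix a x assume "a \<in> ?N" "x \<in> carrier R"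
    then show "x \<otimes> a \<in> ?N" "a \<otimes> x \<in> ?N"
      using nonunit_mult_closed[of a x] m_comm[of x a] by auto
  qed
  have proper: "?N \<noteq> carrier R" using Units_one_closed one_closed by blast
  have "maximalideal ?N R"
    by (rule maximalidealI) (use N proper ideal_subset_nonunits in blast)+
  moreover have "M = ?N" if M: "maximalideal M R" for M
  proof -
    interpret M: maximalideal M R by fact
    \<comment> \<open>\<open>M\<close> is proper, so \<open>M \<subseteq> ?N\<close>; maximality of
      \<open>M\<close> then leaves only \<open>?N = M\<close>, because \<open>?N\<close> is proper
      too.\<close>
    show ?thesis
      using M.I_maximal[OF N] ideal_subset_nonunits[OF M.ideal_axioms] M.I_notcarr proper by blast
  qed
  ultimately show ?thesis unfolding local_ring_def using cring_axioms by blast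
qed

text \<open>If \<open>a \<oplus> b\<close> were a unit, then
  \<open>b = \<ominus> a \<oplus> (a \<oplus> b)\<close> would be a non-unit plus a unit, hence a
  unit by \<open>shift\<close>.\<close>

lemma (in cring) nonunits_add_closed:
  assumes shift: "\<And>a u. a \<in> carrier R - Units R \<Longrightarrow> u \<in> Units R \<Longrightarrow> a \<oplus> u \<in> Units R"
    and a: "a \<in> carrier R - Units R" and b: "b \<in> carrier R - Units R"
  shows "a \<oplus> b \<notin> Units R"
proof
  assume u: "a \<oplus> b \<in> Units R"
  have "\<ominus> a \<oplus> (a \<oplus> b) \<in> Units R" using shift nonunit_minus[OF a] u by blast
  then show False using a b by (simp add: r_neg1)
qed

theorem theorem3p6:
  fixes R :: "('a, 'b) ring_scheme"
  assumes "cring R"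
    and "finite (carrier R)"
    and "complete_bipartite (with_proj (unit_zero_divisor_graph R))"
  shows "local_ring R"
proof -
  interpret cring R by fact
  let ?adj = "\<lambda>u v. (u, v) \<in> parcs (unit_zero_divisor_graph R)"
  obtain V W where VW: "carrier R = V \<union> W" "V \<inter> W = {}" "W \<noteq> {}" and "\<zero>\<^bsub>R\<^esub> \<in> V"
    and arcs: "parcs (unit_zero_divisor_graph R) = V \<times> W \<union> W \<times> V"
  proof -
    have "pverts (unit_zero_divisor_graph R) = carrier R"
      by (simp add: unit_zero_divisor_graph_def)
    then obtain V W where VW: "carrier R = V \<union> W" "V \<inter> W = {}" "card V \<ge> 1" "card W \<ge> 1"
      "parcs (unit_zero_divisor_graph R) = V \<times> W \<union> W \<times> V"
      using assms(3) unfolding complete_bipartite_def complete_bipartite_digraph_pair_def by metis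
    from VW(3,4) have ne: "V \<noteq> {}" "W \<noteq> {}" by auto
    have "\<zero>\<^bsub>R\<^esub> \<in> V \<or> \<zero>\<^bsub>R\<^esub> \<in> W" using VW(1) zero_closed by simp
    \<comment> \<open>The two sides play symmetric roles, so they may be named such that
      \<open>V\<close> is the one containing \<open>\<zero>\<close>.\<close>
    then show thesis
    proof
      assume "\<zero>\<^bsub>R\<^esub> \<in> V"
      then show thesis using that[of V W] VW ne by simp
    next
      assume "\<zero>\<^bsub>R\<^esub> \<in> W"
      then show thesis using that[of W V] VW ne by (simp add: Un_commute Int_commute)
    qed
  qed
  \<comment> \<open>The sum with \<open>\<zero>\<close> is \<open>u\<close> itself, and the product
    is \<open>\<zero>\<close>, a zero divisor by convention.\<close>
  have adj0: "?adj \<zero>\<^bsub>R\<^esub> u \<longleftrightarrow> u \<in> Units R \<and> u \<noteq> \<zero>\<^bsub>R\<^esub>" for u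
    by (auto simp: unit_zero_divisor_graph_def zero_divisors_def Units_closed)
  have adj_sum: "u \<oplus>\<^bsub>R\<^esub> v \<in> Units R" if "?adj u v" for u v
    using that by (auto simp: unit_zero_divisor_graph_def)
  have "?adj \<zero>\<^bsub>R\<^esub> w \<longleftrightarrow> w \<in> W" for w
    using \<open>\<zero>\<^bsub>R\<^esub> \<in> V\<close> VW(2) arcs by auto
  then have W: "W = Units R - {\<zero>\<^bsub>R\<^esub>}"
    using adj0 by blast
  \<comment> \<open>A non-empty \<open>W\<close> yields a nonzero unit, which rules out the zero
    ring, the only ring where \<open>\<zero>\<close> is a unit.\<close>
  then obtain u where "u \<in> Units R" "u \<noteq> \<zero>\<^bsub>R\<^esub>"
    using VW(3) by blast
  then have zero: "\<zero>\<^bsub>R\<^esub> \<notin> Units R"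
    by (metis Units_closed Units_r_inv_ex l_null one_zeroD singletonD)
  \<comment> \<open>With \<open>\<zero>\<close> no unit, \<open>W\<close> is all of
    \<open>Units R\<close> and \<open>V\<close> all non-units; completeness joins every such
    pair.\<close>
  have "?adj a u" if "a \<in> carrier R - Units R" "u \<in> Units R" for a u
  proof -
    have "u \<in> W" using that W zero by auto
    moreover have "a \<in> V" using that W VW(1) by auto
    ultimately show ?thesis using arcs by simp
  qed
  then show ?thesis
    by (intro local_ringI zero nonunits_add_closed) (use adj_sum in auto)
qed

end
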